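(* Let $D$ be a virtual link diagram. Then $J^{\ast}_n(D)=J'^{\ast}_n(D)$ for every integer $n\neq0$ and $P^{\ast}_D(t)=P'^{\ast}_D(t)$ for $\ast\in\{{\rm O},{\rm U}\}$, and $P^{\rm OU}_D(s,t)=P'^{\rm OU}_D(s,t)$.
   Context: A virtual link diagram is a collection of immersed oriented loops in $\mathbb{R}^2$ whose multiple points are transverse double points, each of which is either a classical crossing (with over/under information, and with a sign ${\rm sgn}(c)\in\{+1,-1\}$ as usual) or a virtual crossing (without over/under information). ${\rm Self}X(D)$ is the set of classical self-crossings of $D$, i.e. classical crossings whose over and under paths lie on the same component of $D$. For $c\in{\rm Self}X(D)$, smoothing $D$ at $c$ respecting the orientation splits the component through $c$ into two: the over counting component $D_c^{\rm O}$, which leaves $c$ along the outgoing over strand and returns to $c$ along the incoming under strand, and the under counting component $D_c^{\rm U}$, which leaves $c$ along the outgoing under strand and returns along the incoming over strand. For $\ast\in\{{\rm O},{\rm U}\}$ let $\gamma_1,\dots,\gamma_k$ be the sequence of classical crossings of $D$ met when travelling once along $D_c^\ast$ from a point near $c$ back to that point ($c$ itself is not included; crossings with other components are included; a self-crossing of $D_c^\ast$ appears twice). The flat sign $\iota(\gamma_i,D_c^\ast)$ is ${\rm sgn}(\gamma_i)$ if $\gamma_i$ is passed as an under crossing and $-{\rm sgn}(\gamma_i)$ if passed as an over crossing, and ${\rm ind}^\ast(c)=\sum_i\iota(\gamma_i,D_c^\ast)$. A semi-arc of $D$ is an immersed arc in a component of $D$ whose endpoints are classical crossings (with no classical crossing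 in its interior) or an immersed loop missing the classical crossings; it may pass through virtual crossings. An oriented cut point is a point on a semi-arc (away from crossings) together with a local orientation of the semi-arc there; it is coherent if this local orientation agrees with the orientation of $D$ and incoherent otherwise. A cut system of $D$ is a finite set of oriented cut points such that one can assign integers to the pieces into which the cut points divide the semi-arcs so that: at each classical crossing, viewed so that both strands run upward, for some $i\in\mathbb{Z}$ the incoming and outgoing pieces on the right-hand side are both numbered $i$ and the incoming and outgoing pieces on the left-hand side are both numbered $i+1$; numbers are unchanged along a strand through a virtual crossing; and at each oriented cut point the number increases by one in the direction of the cut point. Every virtual link diagram admits a cut system. For a cut system $C$ of $D$, $\rho^\ast(c,C)$ is the number of incoherent cut points of $C$ on $D_c^\ast$ minus the number of coherent ones; it does not depend on $C$, and $\rho^\ast(c)$ denotes $\rho^\ast(c,C)$ for any cut system $C$ of $D$. Define, for $n\neq0$, $$J^{\rm O}_n(D)=\sum_{c\in{\rm Self}X(D):\ {\rm ind}^{\rm O}(c)=n,\ {\rm ind}^{\rm U}(c)\neq 0}{\rm sgn}(c),\qquad J^{\rm U}_n(D)=\sum_{c\in{\rm Self}X(D):\ {\rm ind}^{\rm U}(c)=n,\ {\rm ind}^{\rm O}(c)\neq 0}{\rm sgn}(c),$$ $$P^{\rm O}_D(t)=\sum_{c\in{\rm Self}X(D):\ {\rm ind}^{\rm U}(c)\neq 0}{\rm sgn}(c)(t^{{\rm ind}^{\rm O}(c)}-1),\qquad P^{\rm U}_D(t)=\sum_{c\in{\rm Self}X(D):\ {\rm ind}^{\rm O}(c)\neq 0}{\rm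 sgn}(c)(t^{{\rm ind}^{\rm U}(c)}-1),$$ $$P^{\rm OU}_D(s,t)=\sum_{c\in{\rm Self}X(D)}{\rm sgn}(c)(s^{{\rm ind}^{\rm O}(c)}-1)(t^{{\rm ind}^{\rm U}(c)}-1),$$ and similarly the cut versions $$J'^{\rm O}_n(D)=\sum_{c\in{\rm Self}X(D):\ \rho^{\rm O}(c)=n,\ \rho^{\rm U}(c)\neq 0}{\rm sgn}(c),\qquad J'^{\rm U}_n(D)=\sum_{c\in{\rm Self}X(D):\ \rho^{\rm U}(c)=n,\ \rho^{\rm O}(c)\neq 0}{\rm sgn}(c),$$ $$P'^{\rm O}_D(t)=\sum_{c\in{\rm Self}X(D):\ \rho^{\rm U}(c)\neq 0}{\rm sgn}(c)(t^{\rho^{\rm O}(c)}-1),\qquad P'^{\rm U}_D(t)=\sum_{c\in{\rm Self}X(D):\ \rho^{\rm O}(c)\neq 0}{\rm sgn}(c)(t^{\rho^{\rm U}(c)}-1),$$ $$P'^{\rm OU}_D(s,t)=\sum_{c\in{\rm Self}X(D)}{\rm sgn}(c)(s^{\rho^{\rm O}(c)}-1)(t^{\rho^{\rm U}(c)}-1).$$ *)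

theory Defs
  imports "HOL-Analysis.Analysis" "HOL-Library.Poly_Mapping"
begin

text \<open>
  A diagram is given by parametrised loops \<open>loop D j\<close> of period 1, for \<open>j < ncomp D\<close>. A
  position \<open>(j, t)\<close> with \<open>0 \<le> t < 1\<close> is a point of the domain of the \<open>j\<close>-th
  loop, so that the two strands through a double point are two different positions.
  Crossings are points of the plane; \<open>over D c\<close> and \<open>under D c\<close> are the positions of the
  over and the under path at a classical crossing \<open>c\<close>. A multiple point not in
  \<open>classical D\<close> is a virtual crossing.
\<close>

type_synonym pos = "nat \<times> real"

record vdiagram =
  ncomp :: nat
  loop :: "nat \<Rightarrow> real \<Rightarrow> real^2"
  classical :: "(real^2) set"
  over :: "real^2 \<Rightarrow> pos"
  under :: "real^2 \<Rightarrow> pos"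

definition positions :: "vdiagram \<Rightarrow> pos set" where
  "positions D = {..<ncomp D} \<times> {0..<1}"

definition point :: "vdiagram \<Rightarrow> pos \<Rightarrow> real^2" where
  "point D p = loop D (fst p) (snd p)"

definition tangent :: "vdiagram \<Rightarrow> pos \<Rightarrow> real^2" where
  "tangent D p = vector_derivative (loop D (fst p)) (at (snd p))"

definition preim :: "vdiagram \<Rightarrow> real^2 \<Rightarrow> pos set" where
  "preim D z = {p \<in> positions D. point D p = z}"

definition multiple_points :: "vdiagram \<Rightarrow> (real^2) set" where
  "multiple_points D = {z. \<exists>p \<in> preim D z. \<exists>q \<in> preim D z. p \<noteq> q}"

definition det2 :: "real^2 \<Rightarrow> real^2 \<Rightarrow> real" where
  "det2 v w = v $ 1 * w $ 2 - v $ 2 * w $ 1"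

definition immersed_loop :: "(real \<Rightarrow> real^2) \<Rightarrow> bool" where
  "immersed_loop f \<longleftrightarrow>
     (\<forall>t. f (t + 1) = f t) \<and>
     (\<forall>t. f differentiable at t) \<and>
     continuous_on UNIV (\<lambda>t. vector_derivative f (at t)) \<and>
     (\<forall>t. vector_derivative f (at t) \<noteq> 0)"

text \<open>The finiteness clause is implied by the other ones, by compactness.\<close>

definition virtual_link_diagram :: "vdiagram \<Rightarrow> bool" where
  "virtual_link_diagram D \<longleftrightarrow>
     (\<forall>j < ncomp D. immersed_loop (loop D j)) \<and>
     finite (multiple_points D) \<and>
     (\<forall>z \<in> multiple_points D. \<exists>p q. p \<noteq> q \<and> preim D z = {p, q} \<and>
        det2 (tangent D p) (tangent D q) \<noteq> 0) \<and>
     classical D \<subseteq> multiple_points D \<and>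
     (\<forall>c \<in> classical D. over D c \<noteq> under D c \<and> preim D c = {over D c, under D c})"

text \<open>At a positive crossing the under path crosses the over path from right to left, i.e.
  (over direction, under direction) is a positive basis.\<close>

definition crossing_sign :: "vdiagram \<Rightarrow> real^2 \<Rightarrow> int" where
  "crossing_sign D c =
     (if det2 (tangent D (over D c)) (tangent D (under D c)) > 0 then 1 else - 1)"

definition SelfX :: "vdiagram \<Rightarrow> (real^2) set" where
  "SelfX D = {c \<in> classical D. fst (over D c) = fst (under D c)}"


subsection \<open>Counting components and indices\<close>

datatype ou = StarO | StarU

fun opp :: "ou \<Rightarrow> ou" where
  "opp StarO = StarU"
| "opp StarU = StarO"

fun strand :: "vdiagram \<Rightarrow> ou \<Rightarrow> real^2 \<Rightarrow> pos" where
  "strand D StarO c = over D c"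
| "strand D StarU c = under D c"

text \<open>The open arc travelled from \<open>a\<close> to \<open>b\<close> in positive direction in the circle
  \<open>\<real>/\<int>\<close>, represented by \<open>{0..<1}\<close>.\<close>

definition cyclic_arc :: "real \<Rightarrow> real \<Rightarrow> real set" where
  "cyclic_arc a b = (if a < b then {a<..<b} else {a<..<1} \<union> {0..<b})"

text \<open>The counting component at a self-crossing \<open>c\<close>, with \<open>c\<close> itself removed, as a set of
  positions.\<close>

definition counting_component :: "vdiagram \<Rightarrow> ou \<Rightarrow> real^2 \<Rightarrow> pos set" where
  "counting_component D x c =
     {fst (strand D x c)} \<times> cyclic_arc (snd (strand D x c)) (snd (strand D (opp x) c))"

definition flat_sign :: "vdiagram \<Rightarrow> pos \<Rightarrow> int" where
  "flat_sign D p =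
     (if p = under D (point D p) then crossing_sign D (point D p)
      else - crossing_sign D (point D p))"

text \<open>Summing over positions counts a self-crossing of the counting component twice.\<close>

definition ind :: "vdiagram \<Rightarrow> ou \<Rightarrow> real^2 \<Rightarrow> int" where
  "ind D x c =
     (\<Sum>p \<in> {p \<in> counting_component D x c. point D p \<in> classical D}. flat_sign D p)"


subsection \<open>Cut systems\<close>

text \<open>The local orientation of a cut point is recorded relative to the orientation of the
  diagram.\<close>

datatype cut_orientation = Coherent | Incoherent

type_synonym cut_point = "pos \<times> cut_orientation"

definition breaks :: "vdiagram \<Rightarrow> cut_point set \<Rightarrow> pos set" where
  "breaks D C = {p \<in> positions D. point D p \<in> classical D} \<union> fst ` C"

text \<open>An assignment of integers to the pieces is a function on positions which is constant
  on every arc without breaks (its values at the breaks are irrelevant). The numbers of the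
  pieces ending and starting at a position are its one-sided values there.\<close>

definition number_before :: "(pos \<Rightarrow> int) \<Rightarrow> pos \<Rightarrow> int \<Rightarrow> bool" where
  "number_before \<nu> p i \<longleftrightarrow> (\<forall>\<^sub>F s in at_left (snd p). \<nu> (fst p, frac s) = i)"

definition number_after :: "(pos \<Rightarrow> int) \<Rightarrow> pos \<Rightarrow> int \<Rightarrow> bool" where
  "number_after \<nu> p i \<longleftrightarrow> (\<forall>\<^sub>F s in at_right (snd p). \<nu> (fst p, frac s) = i)"

definition piecewise_constant :: "vdiagram \<Rightarrow> cut_point set \<Rightarrow> (pos \<Rightarrow> int) \<Rightarrow> bool" where
  "piecewise_constant D C \<nu> \<longleftrightarrow>
     (\<forall>j < ncomp D. \<forall>a b. a \<le> b \<and> (\<forall>s \<in> {a..b}. (j, frac s) \<notin> breaks D C) \<longrightarrow>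
        \<nu> (j, frac a) = \<nu> (j, frac b))"

text \<open>If \<open>(tangent D p, tangent D q)\<close> is a positive basis and both strands run upward, then
  the strand at \<open>p\<close> goes from the lower left to the upper right and the strand at \<open>q\<close> from the
  lower right to the upper left.\<close>

definition numbering :: "vdiagram \<Rightarrow> cut_point set \<Rightarrow> (pos \<Rightarrow> int) \<Rightarrow> bool" where
  "numbering D C \<nu> \<longleftrightarrow>
     piecewise_constant D C \<nu> \<and>
     (\<forall>c \<in> classical D. \<forall>p q.
        preim D c = {p, q} \<and> det2 (tangent D p) (tangent D q) > 0 \<longrightarrow>
        (\<exists>i. number_before \<nu> q i \<and> number_after \<nu> p i \<and>
             number_before \<nu> p (i + 1) \<and> number_after \<nu> q (i + 1))) \<and>
     (\<forall>p. (p, Coherent) \<in> C \<longrightarrow>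
        (\<exists>i. number_before \<nu> p i \<and> number_after \<nu> p (i + 1))) \<and>
     (\<forall>p. (p, Incoherent) \<in> C \<longrightarrow>
        (\<exists>i. number_after \<nu> p i \<and> number_before \<nu> p (i + 1)))"

definition cut_system :: "vdiagram \<Rightarrow> cut_point set \<Rightarrow> bool" where
  "cut_system D C \<longleftrightarrow>
     finite C \<and> inj_on fst C \<and>
     (\<forall>p \<in> fst ` C. p \<in> positions D \<and> point D p \<notin> multiple_points D) \<and>
     (\<exists>\<nu>. numbering D C \<nu>)"

definition rho_cut :: "vdiagram \<Rightarrow> cut_point set \<Rightarrow> ou \<Rightarrow> real^2 \<Rightarrow> int" where
  "rho_cut D C x c =
     int (card {p \<in> counting_component D x c. (p, Incoherent) \<in> C}) -
     int (card {p \<in> counting_component D x c. (p, Coherent) \<in> C})"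

definition rho :: "vdiagram \<Rightarrow> ou \<Rightarrow> real^2 \<Rightarrow> int" where
  "rho D x c = (THE r. \<forall>C. cut_system D C \<longrightarrow> rho_cut D C x c = r)"


subsection \<open>The invariants\<close>

text \<open>Laurent polynomials over \<open>\<int>\<close> are finitely supported functions on the exponents with the
  convolution product. The sums are taken for an arbitrary index function \<open>f\<close>, later \<open>ind D\<close> or
  \<open>rho D\<close>.\<close>

type_synonym laurent1 = "int \<Rightarrow>\<^sub>0 int"
type_synonym laurent2 = "(int \<times> int) \<Rightarrow>\<^sub>0 int"

definition t_pow :: "int \<Rightarrow> laurent1" where
  "t_pow k = Poly_Mapping.single k 1"

definition s_pow2 :: "int \<Rightarrow> laurent2" where
  "s_pow2 k = Poly_Mapping.single (k, 0) 1"

definition t_pow2 :: "int \<Rightarrow> laurent2" where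
  "t_pow2 k = Poly_Mapping.single (0, k) 1"

definition J_of :: "(ou \<Rightarrow> real^2 \<Rightarrow> int) \<Rightarrow> vdiagram \<Rightarrow> ou \<Rightarrow> int \<Rightarrow> int" where
  "J_of f D x n = (\<Sum>c \<in> {c \<in> SelfX D. f x c = n \<and> f (opp x) c \<noteq> 0}. crossing_sign D c)"

definition P_of :: "(ou \<Rightarrow> real^2 \<Rightarrow> int) \<Rightarrow> vdiagram \<Rightarrow> ou \<Rightarrow> laurent1" where
  "P_of f D x =
     (\<Sum>c \<in> {c \<in> SelfX D. f (opp x) c \<noteq> 0}. of_int (crossing_sign D c) * (t_pow (f x c) - 1))"

definition POU_of :: "(ou \<Rightarrow> real^2 \<Rightarrow> int) \<Rightarrow> vdiagram \<Rightarrow> laurent2" where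
  "POU_of f D =
     (\<Sum>c \<in> SelfX D.
        of_int (crossing_sign D c) * (s_pow2 (f StarO c) - 1) * (t_pow2 (f StarU c) - 1))"

definition J :: "vdiagram \<Rightarrow> ou \<Rightarrow> int \<Rightarrow> int" where "J D = J_of (ind D) D"
definition P :: "vdiagram \<Rightarrow> ou \<Rightarrow> laurent1" where "P D = P_of (ind D) D"
definition POU :: "vdiagram \<Rightarrow> laurent2" where "POU D = POU_of (ind D) D"

definition J_cut :: "vdiagram \<Rightarrow> ou \<Rightarrow> int \<Rightarrow> int" where "J_cut D = J_of (rho D) D"
definition P_cut :: "vdiagram \<Rightarrow> ou \<Rightarrow> laurent1" where "P_cut D = P_of (rho D) D"
definition POU_cut :: "vdiagram \<Rightarrow> laurent2" where "POU_cut D = POU_of (rho D) D"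

end

theory Submission
  imports Defs
begin

text \<open>
  All six equalities hold summand by summand, because \<^term>\<open>ind D x c = rho D x c\<close> at every
  self-crossing \<open>c\<close> (lemma \<open>rho_eq_ind\<close>).

  Fix a cut system with a numbering \<open>\<nu>\<close> and travel once along the counting component from \<open>c\<close>
  back to \<open>c\<close>. The rule at classical crossings says exactly that \<open>\<nu>\<close> jumps by the flat sign
  of each position passed, and the rule at cut points says that it jumps by 1 at coherent and by
  -1 at incoherent ones. The same rule at \<open>c\<close> itself says that the piece leaving \<open>c\<close> along one
  strand carries the same number as the piece entering \<open>c\<close> along the other strand, so the total
  jump is 0. This total is the index plus the number of coherent cut points minus the number of
  incoherent ones, that is, the index minus \<open>\<rho>\<close> (lemma \<open>rho_cut_eq_ind\<close>).

  As \<^const>\<open>rho\<close> is the common value over all cut systems, one cut system has to be exhibited.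
  At a classical crossing the strand with flat sign 1 has to go up from some \<open>i\<close> to \<open>i + 1\<close> while the
  one with flat sign -1 comes down from \<open>i + 1\<close> to \<open>i\<close>. With \<open>i = 0\<close> everywhere, this is achieved
  by the numbering that is 1 on a short piece after every position of flat sign 1 and before every
  position of flat sign -1, and 0 elsewhere; the outer ends of the short pieces are the cut points
  (lemma \<open>cut_system_nearby_cuts\<close>).

  Components are circles, with domain \<open>{0..<1}\<close>; all limits and intervals are handled on
  the real line, where the position belonging to a real number \<open>t\<close> is \<open>(j, frac t)\<close>. In this way a
  counting component through the base point 0 needs no separate treatment.
\<close>

section \<open>Numberings along a single strand\<close>

text \<open>A step function changes along an interval by the sum of its jumps. Cutting the
  interval at any one jump leaves two intervals with fewer jumps.
  The end values are one-sided limits since a numbering is unspecified at its breaks.\<close>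

lemma sum_of_jumps:
  fixes g h :: "real \<Rightarrow> int"
  assumes "finite B" "a < b"
    and "\<And>u v. a < u \<Longrightarrow> u \<le> v \<Longrightarrow> v < b \<Longrightarrow> {u..v} \<inter> B = {} \<Longrightarrow> g u = g v"
    and "\<And>t. t \<in> B \<Longrightarrow> a < t \<Longrightarrow> t < b \<Longrightarrow>
           \<exists>i. (\<forall>\<^sub>F s in at_left t. g s = i) \<and> (\<forall>\<^sub>F s in at_right t. g s = i + h t)"
    and "\<forall>\<^sub>F s in at_right a. g s = k" "\<forall>\<^sub>F s in at_left b. g s = l"
  shows "l = k + sum h (B \<inter> {a<..<b})"
  using assms(2-)
proof (induction "card (B \<inter> {a<..<b})" arbitrary: a b k l rule: less_induct)
  case less
  note const = less.prems(2) and jumps = less.prems(3)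
  show ?case
  proof (cases "B \<inter> {a<..<b} = {}")
    case True
    obtain u where u: "a < u" "\<And>y. a < y \<Longrightarrow> y < u \<Longrightarrow> g y = k"
      using less.prems(4) unfolding eventually_at_right_field by blast
    obtain v where v: "v < b" "\<And>y. v < y \<Longrightarrow> y < b \<Longrightarrow> g y = l"
      using less.prems(5) unfolding eventually_at_left_field by blast
    obtain x where x: "a < x" "x < min u b"
      using dense[of a "min u b"] u less.prems(1) by auto
    obtain y where y: "max x v < y" "y < b"
      using dense[of "max x v" b] v x by auto
    have "g x = g y"
      by (rule const) (use x y True in auto)
    then show ?thesis
      using True u(2)[of x] v(2)[of y] x y by auto
  next
    case False
    then obtain t where t: "t \<in> B" "a < t" "t < b" by auto
    obtain i where i: "\<forall>\<^sub>F s in at_left t. g s = i" "\<forall>\<^sub>F s in at_right t. g s = i + h t"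
      using jumps[OF t] by blast
    let ?L = "B \<inter> {a<..<t}" and ?R = "B \<inter> {t<..<b}"
    have split: "B \<inter> {a<..<b} = insert t (?L \<union> ?R)"
      using t by auto
    have fin: "finite ?L" "finite ?R" using assms(1) by auto
    have "?L \<subset> B \<inter> {a<..<b}" "?R \<subset> B \<inter> {a<..<b}" using t by auto
    then have card: "card ?L < card (B \<inter> {a<..<b})" "card ?R < card (B \<inter> {a<..<b})"
      using assms(1) by (meson finite_Int psubset_card_mono)+
    have "i = k + sum h ?L"
      by (rule less.hyps[OF card(1)]) (use t less.prems i const jumps in auto)
    moreover have "l = (i + h t) + sum h ?R"
      by (rule less.hyps[OF card(2)]) (use t less.prems i const jumps in auto)
    moreover have "sum h (B \<inter> {a<..<b}) = h t + (sum h ?L + sum h ?R)"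
      unfolding split using fin by (simp add: sum.union_disjoint disjoint_iff)
    ultimately show ?thesis by simp
  qed
qed

lemma frac_diff_of_int: "frac (s - of_int n) = frac (s::real)"
  using frac_add_of_int_right[of s "- n"] by simp

lemma frac_frac_add: "frac (frac s + e) = frac (s + e :: real)"
proof -
  have "frac s + e = s + e - of_int \<lfloor>s\<rfloor>" by (simp add: frac_def)
  then show ?thesis by (simp only: frac_diff_of_int)
qed

lemma frac_frac_diff: "frac (frac s - e) = frac (s - e :: real)"
  using frac_frac_add[of s "- e"] by simp

text \<open>One-sided numbers are defined at positions in the fundamental interval; these two lemmas
  move them to any lift \<open>t\<close> of the position, as translation by an integer preserves \<^const>\<open>frac\<close>.\<close>

lemma number_before_frac:
  "number_before \<nu> (j, frac t) i \<longleftrightarrow> (\<forall>\<^sub>F s in at_left t. \<nu> (j, frac s) = i)"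
proof -
  have "at_left (frac t) = filtermap (\<lambda>s. s - of_int \<lfloor>t\<rfloor>) (at_left t)"
    unfolding frac_def by (rule filtermap_at_left_shift[symmetric])
  then show ?thesis
    by (simp add: number_before_def eventually_filtermap frac_diff_of_int)
qed

lemma number_after_frac:
  "number_after \<nu> (j, frac t) i \<longleftrightarrow> (\<forall>\<^sub>F s in at_right t. \<nu> (j, frac s) = i)"
proof -
  have "at_right (frac t) = filtermap (\<lambda>s. s - of_int \<lfloor>t\<rfloor>) (at_right t)"
    unfolding frac_def by (rule filtermap_at_right_shift[symmetric])
  then show ?thesis
    by (simp add: number_after_def eventually_filtermap frac_diff_of_int)
qed

text \<open>Unrolls an arc of the circle to an interval of the line. When \<open>a = b\<close> both sides are
  the circle without one point.\<close>

lemma bij_betw_frac_cyclic_arc: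
  assumes "0 \<le> a" "a < 1" "0 \<le> b" "b < 1"
  shows "bij_betw frac {a<..<if a < b then b else b + 1} (cyclic_arc a b)"
proof (cases "a < b")
  case True
  have "frac t = t" if "t \<in> {a<..<b}" for t
    using that assms by (auto simp: frac_eq)
  then have "bij_betw frac {a<..<b} {a<..<b}"
    using bij_betw_cong[of "{a<..<b}" frac id] by auto
  then show ?thesis using True by (simp add: cyclic_arc_def)
next
  case False
  have lo: "frac t = t" if "a < t" "t < 1" for t
    using that assms by (auto simp: frac_eq)
  have hi: "frac t = t - 1" if "1 \<le> t" "t < b + 1" for t
    using that assms by (auto simp: frac_unique_iff)
  show ?thesis
    unfolding bij_betw_def
  proof
    show "inj_on frac {a<..<if a < b then b else b + 1}"
    proof (rule inj_onI)
      fix s t assume "s \<in> {a<..<if a < b then b else b + 1}"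
        "t \<in> {a<..<if a < b then b else b + 1}" "frac s = frac t"
      then have "a < s" "s < b + 1" "a < t" "t < b + 1" "frac s = frac t"
        using False by auto
      then show "s = t"
        using lo[of s] lo[of t] hi[of s] hi[of t] False by argo
    qed
    show "frac ` {a<..<if a < b then b else b + 1} = cyclic_arc a b"
    proof (intro equalityI subsetI)
      fix y assume "y \<in> frac ` {a<..<if a < b then b else b + 1}"
      then obtain t where "y = frac t" "a < t" "t < b + 1" using False by auto
      then show "y \<in> cyclic_arc a b"
        using lo[of t] hi[of t] False by (cases "t < 1") (auto simp: cyclic_arc_def)
    next
      fix y assume y: "y \<in> cyclic_arc a b"
      show "y \<in> frac ` {a<..<if a < b then b else b + 1}"
      proof (cases "a < y")
        case True
        have "y < 1" using y False assms by (auto simp: cyclic_arc_def)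
        then show ?thesis using True y False lo[of y] assms
          by (intro image_eqI[of _ _ y]) (auto simp: cyclic_arc_def)
      next
        case False
        then have "0 \<le> y" "y < b" using y \<open>\<not> a < b\<close> by (auto simp: cyclic_arc_def)
        then show ?thesis using hi[of "y + 1"] \<open>\<not> a < b\<close> assms
          by (intro image_eqI[of _ _ "y + 1"]) auto
      qed
    qed
  qed
qed


section \<open>Classical crossings\<close>

lemma det2_swap: "det2 w v = - det2 v w"
  by (simp add: det2_def)

lemma finite_multiple_positions:
  assumes "virtual_link_diagram D"
  shows "finite {p \<in> positions D. point D p \<in> multiple_points D}"
proof -
  have "finite (preim D z)" if "z \<in> multiple_points D" for z
  proof -
    from that assms obtain p q where "preim D z = {p, q}"
      unfolding virtual_link_diagram_def by blast
    then show ?thesis by simp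
  qed
  then have "finite (\<Union>z\<in>multiple_points D. preim D z)"
    using assms unfolding virtual_link_diagram_def by blast
  then show ?thesis
    by (rule rev_finite_subset) (auto simp: preim_def)
qed

text \<open>The strand whose tangent comes first in the positive basis is the over strand at a positive
  crossing and the under strand at a negative one; in both cases its flat sign is -1. The
  numbering rule, which is phrased by bases, thus becomes a rule about flat signs.\<close>

lemma flat_sign_at_crossing:
  assumes "virtual_link_diagram D" "c \<in> classical D"
    and "preim D c = {p, q}" "det2 (tangent D p) (tangent D q) > 0"
  shows "flat_sign D p = - 1" "flat_sign D q = 1"
proof -
  have ou: "over D c \<noteq> under D c" "{p, q} = {over D c, under D c}"
    using assms unfolding virtual_link_diagram_def by auto
  have "p \<in> preim D c" "q \<in> preim D c" using assms(3) by auto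
  then have pt: "point D p = c" "point D q = c" by (auto simp: preim_def)
  from ou consider "p = over D c" "q = under D c" | "p = under D c" "q = over D c"
    by (auto simp: doubleton_eq_iff)
  then have "flat_sign D p = - 1 \<and> flat_sign D q = 1"
    by cases (use assms(4) ou(1) pt det2_swap[of "tangent D q" "tangent D p"]
        in \<open>auto simp: flat_sign_def crossing_sign_def\<close>)
  then show "flat_sign D p = - 1" "flat_sign D q = 1" by auto
qed

lemma positive_basis_at_crossing:
  assumes "virtual_link_diagram D" "c \<in> classical D"
  obtains p q where "preim D c = {p, q}" "{p, q} = {over D c, under D c}" "p \<noteq> q"
    "det2 (tangent D p) (tangent D q) > 0"
proof -
  have ou: "over D c \<noteq> under D c" "preim D c = {over D c, under D c}"
    using assms unfolding virtual_link_diagram_def by auto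
  obtain p q where pq: "p \<noteq> q" "preim D c = {p, q}" "det2 (tangent D p) (tangent D q) \<noteq> 0"
    using assms unfolding virtual_link_diagram_def by blast
  show ?thesis
  proof (cases "det2 (tangent D p) (tangent D q) > 0")
    case True
    then show ?thesis using that[of p q] pq ou by auto
  next
    case False
    then show ?thesis
      using that[of q p] pq ou det2_swap[of "tangent D q" "tangent D p"]
      by (auto simp: insert_commute)
  qed
qed


section \<open>The index counts cut points\<close>

text \<open>The increase of any numbering at a break, as forced by the rules for crossings and cut
  points.\<close>

definition jump :: "vdiagram \<Rightarrow> cut_point set \<Rightarrow> pos \<Rightarrow> int" where
  "jump D C p = (if point D p \<in> classical D then flat_sign D p else 0)
     + of_bool ((p, Coherent) \<in> C) - of_bool ((p, Incoherent) \<in> C)"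

text \<open>A break is a classical position or a cut point of one orientation, never both, because cut points
  avoid multiple points and carry one orientation each; so exactly one term of \<^const>\<open>jump\<close>
  survives and the corresponding rule of a numbering applies.\<close>

lemma number_jump:
  assumes D: "virtual_link_diagram D" and C: "cut_system D C" and \<nu>: "numbering D C \<nu>"
    and p: "p \<in> breaks D C"
  shows "\<exists>i. number_before \<nu> p i \<and> number_after \<nu> p (i + jump D C p)"
proof -
  have cut_simple: "point D p \<notin> classical D" if "(p, o') \<in> C" for o'
    using that C D unfolding cut_system_def virtual_link_diagram_def by force
  have one_cut: "o1 = o2" if "(p, o1) \<in> C" "(p, o2) \<in> C" for o1 o2
    using that C unfolding cut_system_def inj_on_def by force
  have oriented: "(p, Coherent) \<in> C \<or> (p, Incoherent) \<in> C" if "(p, o') \<in> C" for o'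
    using that by (cases o') auto
  have "p \<in> positions D \<and> point D p \<in> classical D \<or> (\<exists>o'. (p, o') \<in> C)"
    using p unfolding breaks_def by force
  then consider "p \<in> positions D" "point D p \<in> classical D" | "(p, Coherent) \<in> C" | "(p, Incoherent) \<in> C"
    using oriented by blast
  then show ?thesis
  proof cases
    case 1
    have J: "jump D C p = flat_sign D p"
      using 1 cut_simple by (auto simp: jump_def)
    obtain r q where rq: "preim D (point D p) = {r, q}" "det2 (tangent D r) (tangent D q) > 0"
      by (rule positive_basis_at_crossing[OF D 1(2)]) blast
    obtain i where i: "number_before \<nu> q i" "number_after \<nu> r i"
      "number_before \<nu> r (i + 1)" "number_after \<nu> q (i + 1)"
      using \<nu> 1(2) rq unfolding numbering_def by blast
    have "p \<in> {r, q}" using 1 rq(1) by (auto simp: preim_def)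
    then show ?thesis
    proof
      assume "p = r"
      then show ?thesis
        using i flat_sign_at_crossing(1)[OF D 1(2) rq] J by (intro exI[of _ "i + 1"]) auto
    next
      assume "p \<in> {q}"
      then show ?thesis
        using i flat_sign_at_crossing(2)[OF D 1(2) rq] J by (intro exI[of _ i]) auto
    qed
  next
    case 2
    then have "jump D C p = 1"
      using cut_simple one_cut by (auto simp: jump_def)
    moreover obtain i where "number_before \<nu> p i" "number_after \<nu> p (i + 1)"
      using \<nu> 2 unfolding numbering_def by blast
    ultimately show ?thesis by (intro exI[of _ i]) auto
  next
    case 3
    then have "jump D C p = - 1"
      using cut_simple one_cut by (auto simp: jump_def)
    moreover obtain i where "number_after \<nu> p i" "number_before \<nu> p (i + 1)"
      using \<nu> 3 unfolding numbering_def by blast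
    ultimately show ?thesis by (intro exI[of _ "i + 1"]) auto
  qed
qed

text \<open>Closes the loop at the self-crossing: smoothing respecting the orientation joins the two
  right-hand pieces, both numbered \<open>i\<close>, and the two left-hand pieces, both numbered \<open>i + 1\<close>.\<close>

lemma same_number_on_both_strands:
  assumes D: "virtual_link_diagram D" and \<nu>: "numbering D C \<nu>" and c: "c \<in> classical D"
  shows "\<exists>i. number_after \<nu> (strand D x c) i \<and> number_before \<nu> (strand D (opp x) c) i"
proof -
  obtain p q where pq: "preim D c = {p, q}" "{p, q} = {over D c, under D c}" "p \<noteq> q"
    "det2 (tangent D p) (tangent D q) > 0"
    by (rule positive_basis_at_crossing[OF D c]) blast
  obtain i where i: "number_before \<nu> q i" "number_after \<nu> p i"
    "number_before \<nu> p (i + 1)" "number_after \<nu> q (i + 1)"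
    using \<nu> c pq unfolding numbering_def by blast
  have "(strand D x c = p \<and> strand D (opp x) c = q) \<or> (strand D x c = q \<and> strand D (opp x) c = p)"
    using pq(2,3) by (cases x) (auto simp: doubleton_eq_iff)
  then show ?thesis using i by blast
qed

lemma finite_breaks:
  assumes D: "virtual_link_diagram D" and "finite C"
  shows "finite (breaks D C)"
proof -
  have "{p \<in> positions D. point D p \<in> classical D} \<subseteq> {p \<in> positions D. point D p \<in> multiple_points D}"
    using D unfolding virtual_link_diagram_def by auto
  then show ?thesis
    unfolding breaks_def
    using finite_subset finite_multiple_positions[OF D] assms(2) by blast
qed

lemma sum_jump_eq:
  assumes D: "virtual_link_diagram D" and C: "finite C"
    and A: "A \<subseteq> positions D"
  shows "sum (jump D C) (A \<inter> breaks D C) =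
    (\<Sum>p \<in> {p \<in> A. point D p \<in> classical D}. flat_sign D p)
    + int (card {p \<in> A. (p, Coherent) \<in> C}) - int (card {p \<in> A. (p, Incoherent) \<in> C})"
proof -
  let ?K = "A \<inter> breaks D C"
  have fin: "finite ?K" using finite_breaks[OF D C] by blast
  have 1: "{p \<in> ?K. point D p \<in> classical D} = {p \<in> A. point D p \<in> classical D}"
    using A by (auto simp: breaks_def)
  have 2: "{p \<in> ?K. (p, o') \<in> C} = {p \<in> A. (p, o') \<in> C}" for o'
    by (force simp: breaks_def)
  have "sum (jump D C) ?K = (\<Sum>p\<in>?K. if point D p \<in> classical D then flat_sign D p else 0)
      + (\<Sum>p\<in>?K. of_bool ((p, Coherent) \<in> C)) - (\<Sum>p\<in>?K. of_bool ((p, Incoherent) \<in> C))"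
    by (subst sum.cong[OF refl jump_def]) (simp only: sum.distrib sum_subtractf)
  also have "\<dots> = (\<Sum>p \<in> {p \<in> ?K. point D p \<in> classical D}. flat_sign D p)
      + int (card {p \<in> ?K. (p, Coherent) \<in> C}) - int (card {p \<in> ?K. (p, Incoherent) \<in> C})"
    using fin by (simp add: sum.inter_filter[symmetric] of_bool_def)
  finally show ?thesis by (simp only: 1 2)
qed

text \<open>The numbers at the two ends of the counting component agree, so the jumps in between add up to
  zero.\<close>

lemma rho_cut_eq_ind:
  assumes D: "virtual_link_diagram D" and C: "cut_system D C" and c: "c \<in> SelfX D"
  shows "rho_cut D C x c = ind D x c"
proof -
  obtain \<nu> where \<nu>: "numbering D C \<nu>" using C unfolding cut_system_def by blast
  have finC: "finite C" using C unfolding cut_system_def by blast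
  have cl: "c \<in> classical D" and comp: "fst (over D c) = fst (under D c)"
    using c by (auto simp: SelfX_def)
  have "over D c \<in> preim D c" "under D c \<in> preim D c"
    using D cl unfolding virtual_link_diagram_def by auto
  then have pos: "over D c \<in> positions D" "under D c \<in> positions D"
    by (auto simp: preim_def)
  define j where "j = fst (strand D x c)"
  define a where "a = snd (strand D x c)"
  define b' where "b' = snd (strand D (opp x) c)"
  \<comment> \<open>the end of the arc on the real line, at least 1 if the arc does not end before the base point\<close>
  define b where "b = (if a < b' then b' else b' + 1)"
  have S: "strand D x c = (j, a)" "strand D (opp x) c = (j, b')"
    using comp unfolding j_def a_def b'_def by (cases x; simp add: prod_eq_iff)+
  have j: "j < ncomp D" and ab: "0 \<le> a" "a < 1" "0 \<le> b'" "b' < 1"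
    using pos unfolding j_def a_def b'_def by (cases x; auto simp: positions_def)+
  have fr: "frac a = a" "frac b = b'" and "a < b"
    using ab by (auto simp: b_def frac_eq frac_1_eq)
  define A where "A = counting_component D x c"
  have A: "A = {j} \<times> cyclic_arc a b'"
    unfolding A_def counting_component_def S by simp
  have bijA: "bij_betw (\<lambda>t. (j, frac t)) {a<..<b} A"
  proof -
    have "bij_betw frac {a<..<b} (cyclic_arc a b')"
      using bij_betw_frac_cyclic_arc[OF ab] unfolding b_def .
    moreover have "(\<lambda>t. (j, frac t)) ` {a<..<b} = {j} \<times> frac ` {a<..<b}" by auto
    ultimately show ?thesis
      unfolding A bij_betw_def by (simp add: inj_on_def)
  qed
  have Apos: "A \<subseteq> positions D"
    using j ab unfolding A positions_def cyclic_arc_def by auto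
  define B where "B = {t \<in> {a<..<b}. (j, frac t) \<in> breaks D C}"
  have bij: "bij_betw (\<lambda>t. (j, frac t)) B (A \<inter> breaks D C)"
    using bijA unfolding B_def bij_betw_def inj_on_def by blast
  have finB: "finite B"
    using bij_betw_finite[OF bij] finite_breaks[OF D finC] by blast
  obtain i where i: "number_after \<nu> (j, a) i" "number_before \<nu> (j, b') i"
    using same_number_on_both_strands[OF D \<nu> cl, of x] unfolding S by blast
  have "i = i + (\<Sum>t \<in> B \<inter> {a<..<b}. jump D C (j, frac t))"
  proof (rule sum_of_jumps[where g = "\<lambda>t. \<nu> (j, frac t)", OF finB \<open>a < b\<close>])
    fix u v assume uv: "a < u" "u \<le> v" "v < b" "{u..v} \<inter> B = {}"
    then have "\<forall>s \<in> {u..v}. (j, frac s) \<notin> breaks D C"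
      unfolding B_def by fastforce
    then show "\<nu> (j, frac u) = \<nu> (j, frac v)"
      using \<nu> uv(2) j unfolding numbering_def piecewise_constant_def by blast
  next
    fix t assume "t \<in> B"
    then show "\<exists>k. (\<forall>\<^sub>F s in at_left t. \<nu> (j, frac s) = k) \<and>
        (\<forall>\<^sub>F s in at_right t. \<nu> (j, frac s) = k + jump D C (j, frac t))"
      using number_jump[OF D C \<nu>, of "(j, frac t)"]
      unfolding B_def number_before_frac number_after_frac by blast
  next
    show "\<forall>\<^sub>F s in at_right a. \<nu> (j, frac s) = i"
      using i(1) number_after_frac[of \<nu> j a] fr by simp
    show "\<forall>\<^sub>F s in at_left b. \<nu> (j, frac s) = i"
      using i(2) number_before_frac[of \<nu> j b] fr by simp
  qed
  moreover have "B \<inter> {a<..<b} = B" by (auto simp: B_def)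
  ultimately have "sum (jump D C) (A \<inter> breaks D C) = 0"
    using sum.reindex_bij_betw[OF bij, of "jump D C"] by simp
  then show ?thesis
    using sum_jump_eq[OF D finC Apos] unfolding rho_cut_def ind_def A_def by simp
qed


section \<open>A cut system next to the crossings\<close>

text \<open>The positions of the finitely many multiple points are separated on each circle,
  hence so are their lifts to the line. The factor 3 leaves room for a short piece of length
  \<open>e\<close> at each of two neighbouring lifts and a gap of length at least \<open>e\<close> between them.\<close>

lemma separated_multiple_positions:
  assumes "virtual_link_diagram D"
  obtains e where "e > 0"
    "\<And>j s t. (j, frac s) \<in> {p \<in> positions D. point D p \<in> multiple_points D} \<Longrightarrow>
       (j, frac t) \<in> {p \<in> positions D. point D p \<in> multiple_points D} \<Longrightarrow>
       \<bar>s - t\<bar> < 3 * e \<Longrightarrow> s = t"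
proof -
  let ?M = "{p \<in> positions D. point D p \<in> multiple_points D}"
  \<comment> \<open>Translated so that one of them lies in the fundamental interval, two lifts at distance less
    than 1 both lie in the union \<open>F\<close> of three consecutive copies of the fundamental interval.\<close>
  define F where "F = (\<lambda>(k, s). s + of_int k) ` ({-1..1::int} \<times> snd ` ?M)"
  have "finite F" unfolding F_def using finite_multiple_positions[OF assms] by auto
  then have "uniform_discrete F" using uniform_discrete_finite_iff by blast
  then obtain d where d: "d > 0" "\<And>s t. s \<in> F \<Longrightarrow> t \<in> F \<Longrightarrow> \<bar>s - t\<bar> < d \<Longrightarrow> s = t"
    unfolding uniform_discrete_def dist_real_def by blast
  show ?thesis
  proof
    show "min d 1 / 3 > 0" using d by simp
    fix j s t
    assume s: "(j, frac s) \<in> ?M" and t: "(j, frac t) \<in> ?M" and st: "\<bar>s - t\<bar> < 3 * (min d 1 / 3)"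
    define k where "k = \<lfloor>t\<rfloor> - \<lfloor>s\<rfloor>"
    have k: "t - of_int \<lfloor>s\<rfloor> = frac t + of_int k" "s - of_int \<lfloor>s\<rfloor> = frac s + of_int 0"
      by (auto simp: k_def frac_def)
    have "frac s - (frac t + of_int k) = s - t" by (simp add: k_def frac_def)
    then have "\<bar>frac s - (frac t + of_int k)\<bar> < 1" using st by simp
    moreover have "0 \<le> frac s" "frac s < 1" "0 \<le> frac t" "frac t < 1" by (auto simp: frac_lt_1)
    ultimately have "of_int k < (2::real)" "of_int k > (-2::real)" by linarith+
    then have "k \<in> {-1..1}" by auto
    have in_F: "frac r + of_int l \<in> F" if "(j, frac r) \<in> ?M" "l \<in> {-1..1}" for r l
      unfolding F_def using that imageI[OF that(1), of snd]
      by (intro image_eqI[of _ _ "(l, frac r)"]) simp_all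
    have "frac t + of_int k \<in> F" "frac s + of_int 0 \<in> F"
      using in_F[OF t \<open>k \<in> {-1..1}\<close>] in_F[OF s, of 0] by auto
    then have "s - of_int \<lfloor>s\<rfloor> = t - of_int \<lfloor>s\<rfloor>"
      using st unfolding k[symmetric] by (intro d(2)) auto
    then show "s = t" by simp
  qed
qed

definition crossing_positions :: "vdiagram \<Rightarrow> int \<Rightarrow> pos set" where
  "crossing_positions D k = {p \<in> positions D. point D p \<in> classical D \<and> flat_sign D p = k}"

text \<open>The part of the line numbered 1: open pieces of length \<open>e\<close> after positions of flat
  sign 1 and before positions of flat sign -1.\<close>

definition raised :: "vdiagram \<Rightarrow> real \<Rightarrow> nat \<Rightarrow> real \<Rightarrow> bool" where
  "raised D e j t \<longleftrightarrow>
     (\<exists>s. s < t \<and> t < s + e \<and> (j, frac s) \<in> crossing_positions D 1) \<or>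
     (\<exists>s. t < s \<and> s < t + e \<and> (j, frac s) \<in> crossing_positions D (- 1))"

text \<open>The outer ends of the raised pieces: the number falls at the end of a piece after a crossing
  and rises at the start of a piece before one. The set is described by the crossing found at distance
  \<open>e\<close> from the cut point, so that membership of a lifted point can be rewritten without a witness.\<close>

definition nearby_cuts :: "vdiagram \<Rightarrow> real \<Rightarrow> cut_point set" where
  "nearby_cuts D e =
     {((j, u), Incoherent) | j u. 0 \<le> u \<and> u < 1 \<and> (j, frac (u - e)) \<in> crossing_positions D 1} \<union>
     {((j, u), Coherent) | j u. 0 \<le> u \<and> u < 1 \<and> (j, frac (u + e)) \<in> crossing_positions D (- 1)}"

lemma nearby_cuts_frac:
  "((j, frac t), Incoherent) \<in> nearby_cuts D e \<longleftrightarrow> (j, frac (t - e)) \<in> crossing_positions D 1"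
  "((j, frac t), Coherent) \<in> nearby_cuts D e \<longleftrightarrow> (j, frac (t + e)) \<in> crossing_positions D (- 1)"
  by (auto simp: nearby_cuts_def frac_lt_1 frac_frac_diff frac_frac_add)

lemma nearby_cutsE:
  assumes "(p, o') \<in> nearby_cuts D e"
  obtains j t where "p = (j, frac t)"
proof -
  have "frac (snd p) = snd p"
    using assms by (auto simp: nearby_cuts_def frac_eq)
  then show ?thesis
    using that[of "fst p" "snd p"] by simp
qed

lemma raised_frac: "raised D e j (frac t) = raised D e j t"
proof -
  have shift: "raised D e j (t - of_int n)" if "raised D e j t" for t and n :: int
    using that unfolding raised_def
  proof (elim disjE exE conjE)
    fix s assume "s < t" "t < s + e" "(j, frac s) \<in> crossing_positions D 1"
    then show "(\<exists>s. s < t - of_int n \<and> t - of_int n < s + e \<and> (j, frac s) \<in> crossing_positions D 1) \<or>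
      (\<exists>s. t - of_int n < s \<and> s < t - of_int n + e \<and> (j, frac s) \<in> crossing_positions D (- 1))"
      by (intro disjI1 exI[of _ "s - of_int n"]) (simp add: frac_diff_of_int)
  next
    fix s assume "t < s" "s < t + e" "(j, frac s) \<in> crossing_positions D (- 1)"
    then show "(\<exists>s. s < t - of_int n \<and> t - of_int n < s + e \<and> (j, frac s) \<in> crossing_positions D 1) \<or>
      (\<exists>s. t - of_int n < s \<and> s < t - of_int n + e \<and> (j, frac s) \<in> crossing_positions D (- 1))"
      by (intro disjI2 exI[of _ "s - of_int n"]) (simp add: frac_diff_of_int)
  qed
  show ?thesis
    using shift[of t "\<lfloor>t\<rfloor>"] shift[of "frac t" "- \<lfloor>t\<rfloor>"] by (auto simp: frac_def)
qed

text \<open>Both ends of each raised piece are breaks, so an interval without breaks lies inside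
  the piece or misses it.\<close>

lemma raised_piecewise_constant:
  "piecewise_constant D (nearby_cuts D e) (\<lambda>(j, t). of_bool (raised D e j t))"
proof -
  have "raised D e j a = raised D e j b"
    if le: "a \<le> b" and nb: "\<And>s. a \<le> s \<Longrightarrow> s \<le> b \<Longrightarrow> (j, frac s) \<notin> breaks D (nearby_cuts D e)"
    for j a b
  proof -
    have nc: "\<not> (a \<le> s \<and> s \<le> b)" if "(j, frac s) \<in> crossing_positions D k" for s k
      using that nb[of s] by (auto simp: breaks_def crossing_positions_def)
    have ni: "\<not> (a \<le> s + e \<and> s + e \<le> b)" if "(j, frac s) \<in> crossing_positions D 1" for s
    proof -
      have "((j, frac (s + e)), Incoherent) \<in> nearby_cuts D e"
        using that by (simp add: nearby_cuts_frac)
      then have "(j, frac (s + e)) \<in> breaks D (nearby_cuts D e)"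
        unfolding breaks_def by force
      then show ?thesis using nb by blast
    qed
    have nd: "\<not> (a \<le> s - e \<and> s - e \<le> b)" if "(j, frac s) \<in> crossing_positions D (- 1)" for s
    proof -
      have "((j, frac (s - e)), Coherent) \<in> nearby_cuts D e"
        using that by (simp add: nearby_cuts_frac)
      then have "(j, frac (s - e)) \<in> breaks D (nearby_cuts D e)"
        unfolding breaks_def by force
      then show ?thesis using nb by blast
    qed
    have "(s < a \<and> a < s + e) = (s < b \<and> b < s + e)"
      if "(j, frac s) \<in> crossing_positions D 1" for s
      using nc[OF that] ni[OF that] le by linarith
    moreover have "(a < s \<and> s < a + e) = (b < s \<and> s < b + e)"
      if "(j, frac s) \<in> crossing_positions D (- 1)" for s
      using nc[OF that] nd[OF that] le by linarith
    ultimately show ?thesis unfolding raised_def by blast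
  qed
  then show ?thesis
    unfolding piecewise_constant_def by (auto simp: raised_frac)
qed

text \<open>By the separation of the crossings, within distance \<open>2 * e\<close> of a classical position only the raised
  piece at that position can be met. This determines all four one-sided numbers at the position and
  at its cut point, and it keeps the cut points distinct and away from multiple points.\<close>

lemma cut_system_nearby_cuts:
  assumes D: "virtual_link_diagram D" and e: "e > 0"
    and sep: "\<And>j s t. (j, frac s) \<in> {p \<in> positions D. point D p \<in> multiple_points D} \<Longrightarrow>
       (j, frac t) \<in> {p \<in> positions D. point D p \<in> multiple_points D} \<Longrightarrow>
       \<bar>s - t\<bar> < 3 * e \<Longrightarrow> s = t"
  shows "cut_system D (nearby_cuts D e)"
proof -
  let ?M = "{p \<in> positions D. point D p \<in> multiple_points D}"
  let ?C = "nearby_cuts D e" and ?\<nu> = "\<lambda>(j, t). of_bool (raised D e j t) :: int"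
  have sub: "crossing_positions D k \<subseteq> ?M" for k
    using D unfolding crossing_positions_def virtual_link_diagram_def by auto
  then have fincp: "finite (crossing_positions D k)" for k
    using finite_multiple_positions[OF D] finite_subset by blast
  have disj: "p \<notin> crossing_positions D (- 1)" if "p \<in> crossing_positions D 1" for p
    using that by (auto simp: crossing_positions_def)
  have near: "raised D e j t \<longleftrightarrow>
      (s < t \<and> t < s + e \<and> (j, frac s) \<in> crossing_positions D 1) \<or>
      (t < s \<and> s < t + e \<and> (j, frac s) \<in> crossing_positions D (- 1))"
    if s: "(j, frac s) \<in> ?M" and st: "\<bar>t - s\<bar> < 2 * e" for j s t
  proof -
    have "s' = s" if "(j, frac s') \<in> crossing_positions D k" "\<bar>t - s'\<bar> < e" for s' k
      by (rule sep[OF _ s]) (use that sub st in auto)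
    note uniq = this
    have "s' = s" if "s' < t" "t < s' + e" "(j, frac s') \<in> crossing_positions D 1" for s'
      by (rule uniq) (use that in auto)
    moreover have "s' = s" if "t < s'" "s' < t + e" "(j, frac s') \<in> crossing_positions D (- 1)" for s'
      by (rule uniq) (use that in auto)
    ultimately show ?thesis unfolding raised_def by blast
  qed
  have pos: "number_before ?\<nu> (j, frac s) 0 \<and> number_after ?\<nu> (j, frac s) 1 \<and>
      number_before ?\<nu> (j, frac (s + e)) 1 \<and> number_after ?\<nu> (j, frac (s + e)) 0"
    if s: "(j, frac s) \<in> crossing_positions D 1" for j s
  proof -
    have eq: "raised D e j t \<longleftrightarrow> s < t \<and> t < s + e" if "\<bar>t - s\<bar> < 2 * e" for t
      using near[OF _ that] s sub disj[OF s] by blast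
    show ?thesis
      unfolding number_before_frac number_after_frac
    proof (intro conjI)
      show "\<forall>\<^sub>F t in at_left s. ?\<nu> (j, frac t) = 0"
        by (rule eventually_at_leftI[of "s - e"]) (use e eq in \<open>auto simp: raised_frac\<close>)
      show "\<forall>\<^sub>F t in at_right s. ?\<nu> (j, frac t) = 1"
        by (rule eventually_at_rightI[of _ "s + e"]) (use e eq in \<open>auto simp: raised_frac\<close>)
      show "\<forall>\<^sub>F t in at_left (s + e). ?\<nu> (j, frac t) = 1"
        by (rule eventually_at_leftI[of s]) (use e eq in \<open>auto simp: raised_frac\<close>)
      show "\<forall>\<^sub>F t in at_right (s + e). ?\<nu> (j, frac t) = 0"
        by (rule eventually_at_rightI[of _ "s + 2 * e"]) (use e eq in \<open>auto simp: raised_frac\<close>)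
    qed
  qed
  have neg: "number_before ?\<nu> (j, frac s) 1 \<and> number_after ?\<nu> (j, frac s) 0 \<and>
      number_before ?\<nu> (j, frac (s - e)) 0 \<and> number_after ?\<nu> (j, frac (s - e)) 1"
    if s: "(j, frac s) \<in> crossing_positions D (- 1)" for j s
  proof -
    have eq: "raised D e j t \<longleftrightarrow> t < s \<and> s < t + e" if "\<bar>t - s\<bar> < 2 * e" for t
      using near[OF _ that] s sub disj by blast
    show ?thesis
      unfolding number_before_frac number_after_frac
    proof (intro conjI)
      show "\<forall>\<^sub>F t in at_left s. ?\<nu> (j, frac t) = 1"
        by (rule eventually_at_leftI[of "s - e"]) (use e eq in \<open>auto simp: raised_frac\<close>)
      show "\<forall>\<^sub>F t in at_right s. ?\<nu> (j, frac t) = 0"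
        by (rule eventually_at_rightI[of _ "s + e"]) (use e eq in \<open>auto simp: raised_frac\<close>)
      show "\<forall>\<^sub>F t in at_left (s - e). ?\<nu> (j, frac t) = 0"
        by (rule eventually_at_leftI[of "s - 2 * e"]) (use e eq in \<open>auto simp: raised_frac\<close>)
      show "\<forall>\<^sub>F t in at_right (s - e). ?\<nu> (j, frac t) = 1"
        by (rule eventually_at_rightI[of _ s]) (use e eq in \<open>auto simp: raised_frac\<close>)
    qed
  qed
  have "numbering D ?C ?\<nu>"
    unfolding numbering_def
  proof (intro conjI ballI allI impI raised_piecewise_constant)
    fix c p q assume c: "c \<in> classical D"
      and pq: "preim D c = {p, q} \<and> det2 (tangent D p) (tangent D q) > 0"
    have "p \<in> preim D c" "q \<in> preim D c" using pq by auto
    then have in_pos: "p \<in> crossing_positions D (- 1)" "q \<in> crossing_positions D 1"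
      using flat_sign_at_crossing[OF D c] pq c by (auto simp: preim_def crossing_positions_def)
    then have "p = (fst p, frac (snd p))" "q = (fst q, frac (snd q))"
      by (auto simp: crossing_positions_def positions_def)
    then show "\<exists>i. number_before ?\<nu> q i \<and> number_after ?\<nu> p i \<and>
        number_before ?\<nu> p (i + 1) \<and> number_after ?\<nu> q (i + 1)"
      using pos[of "fst q" "snd q"] neg[of "fst p" "snd p"] in_pos
      by (intro exI[of _ 0]) simp
  next
    fix p assume p: "(p, Coherent) \<in> ?C"
    then obtain j t where "p = (j, frac t)" by (rule nearby_cutsE)
    then show "\<exists>i. number_before ?\<nu> p i \<and> number_after ?\<nu> p (i + 1)"
      using p neg[of j "t + e"] by (intro exI[of _ 0]) (simp add: nearby_cuts_frac)
  next
    fix p assume p: "(p, Incoherent) \<in> ?C"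
    then obtain j t where "p = (j, frac t)" by (rule nearby_cutsE)
    then show "\<exists>i. number_after ?\<nu> p i \<and> number_before ?\<nu> p (i + 1)"
      using p pos[of j "t - e"] by (intro exI[of _ 0]) (simp add: nearby_cuts_frac)
  qed
  moreover have "finite ?C"
  proof -
    have "?C \<subseteq> (\<lambda>(j, s). ((j, frac (s + e)), Incoherent)) ` crossing_positions D 1 \<union>
        (\<lambda>(j, s). ((j, frac (s - e)), Coherent)) ` crossing_positions D (- 1)"
    proof
      fix x assume x: "x \<in> ?C"
      obtain p o' where [simp]: "x = (p, o')" by fastforce
      obtain j t where [simp]: "p = (j, frac t)" using x by (auto elim: nearby_cutsE)
      show "x \<in> (\<lambda>(j, s). ((j, frac (s + e)), Incoherent)) ` crossing_positions D 1 \<union>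
        (\<lambda>(j, s). ((j, frac (s - e)), Coherent)) ` crossing_positions D (- 1)"
      proof (cases o')
        case Coherent
        then show ?thesis using x
          by (intro UnI2 image_eqI[of _ _ "(j, frac (t + e))"])
            (auto simp: nearby_cuts_frac frac_frac_diff)
      next
        case Incoherent
        then show ?thesis using x
          by (intro UnI1 image_eqI[of _ _ "(j, frac (t - e))"])
            (auto simp: nearby_cuts_frac frac_frac_add)
      qed
    qed
    then show ?thesis using fincp by (meson finite_Un finite_imageI finite_subset)
  qed
  moreover have "inj_on fst ?C"
  proof (rule inj_onI)
    fix x y assume xy: "x \<in> ?C" "y \<in> ?C" "fst x = fst y"
    obtain p o1 o2 where [simp]: "x = (p, o1)" "y = (p, o2)" using xy(3) by (metis prod.collapse)
    obtain j t where p: "p = (j, frac t)" using xy by (auto elim: nearby_cutsE)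
    \<comment> \<open>A cut point with both orientations would have crossings at distance \<open>e\<close> on either side.\<close>
    have "\<not> ((p, Incoherent) \<in> ?C \<and> (p, Coherent) \<in> ?C)"
    proof
      assume "(p, Incoherent) \<in> ?C \<and> (p, Coherent) \<in> ?C"
      then have "(j, frac (t - e)) \<in> ?M" "(j, frac (t + e)) \<in> ?M"
        using sub unfolding p nearby_cuts_frac by blast+
      from sep[OF this] show False using e by simp
    qed
    then show "x = y" using xy by (cases o1; cases o2) auto
  qed
  moreover have "p \<in> positions D \<and> point D p \<notin> multiple_points D"
    if p_cut: "p \<in> fst ` ?C" for p
  proof -
    obtain o' where o': "(p, o') \<in> ?C" using p_cut by fastforce
    obtain j t where p: "p = (j, frac t)" using o' by (rule nearby_cutsE)
    \<comment> \<open>A multiple point at \<open>t\<close> would be too close to the crossing that \<open>t\<close> was placed next to.\<close>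
    obtain s where s: "(j, frac s) \<in> ?M" "\<bar>t - s\<bar> = e"
    proof (cases o')
      case Coherent
      then show ?thesis using that[of "t + e"] o' sub e unfolding p
        by (auto simp: nearby_cuts_frac)
    next
      case Incoherent
      then show ?thesis using that[of "t - e"] o' sub e unfolding p
        by (auto simp: nearby_cuts_frac)
    qed
    have "p \<in> positions D" using s(1) by (auto simp: p positions_def frac_lt_1)
    moreover have "p \<notin> ?M"
      using sep[of j t s] s e unfolding p by auto
    ultimately show ?thesis by blast
  qed
  ultimately show ?thesis unfolding cut_system_def by blast
qed

lemma cut_system_exists:
  assumes "virtual_link_diagram D"
  shows "\<exists>C. cut_system D C"
proof (rule separated_multiple_positions[OF assms])
  fix e :: real
  assume "e > 0"
    "\<And>j s t. (j, frac s) \<in> {p \<in> positions D. point D p \<in> multiple_points D} \<Longrightarrow>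
       (j, frac t) \<in> {p \<in> positions D. point D p \<in> multiple_points D} \<Longrightarrow>
       \<bar>s - t\<bar> < 3 * e \<Longrightarrow> s = t"
  then have "cut_system D (nearby_cuts D e)"
    by (rule cut_system_nearby_cuts[OF assms])
  then show ?thesis ..
qed


section \<open>Equality of the invariants\<close>

text \<open>Existence of a cut system is what gives the definite description of \<^const>\<open>rho\<close> a unique
  solution.\<close>

lemma rho_eq_ind:
  assumes D: "virtual_link_diagram D" and c: "c \<in> SelfX D"
  shows "rho D x c = ind D x c"
proof -
  obtain C where "cut_system D C" using cut_system_exists[OF D] by blast
  then show ?thesis
    unfolding rho_def using rho_cut_eq_ind[OF D _ c, of _ x] by (intro the_equality) auto
qed

theorem corollary19:
  fixes D :: vdiagram
  assumes "virtual_link_diagram D"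
  shows "(\<forall>x n. n \<noteq> 0 \<longrightarrow> J D x n = J_cut D x n) \<and>
         (\<forall>x. P D x = P_cut D x) \<and>
         POU D = POU_cut D"
proof -
  note eq = rho_eq_ind[OF assms]
  have filter: "{c \<in> SelfX D. Q (rho D StarO c) (rho D StarU c)} =
      {c \<in> SelfX D. Q (ind D StarO c) (ind D StarU c)}" for Q
    using eq by auto
  have "J D x n = J_cut D x n" for x n
    unfolding J_def J_cut_def J_of_def
    using filter[of "\<lambda>k l. k = n \<and> l \<noteq> 0"] filter[of "\<lambda>k l. l = n \<and> k \<noteq> 0"] by (cases x) simp_all
  moreover have "P D x = P_cut D x" for x
  proof -
    have "{c \<in> SelfX D. ind D (opp x) c \<noteq> 0} = {c \<in> SelfX D. rho D (opp x) c \<noteq> 0}"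
      using eq by auto
    then show ?thesis
      unfolding P_def P_cut_def P_of_def by (rule sum.cong) (simp add: eq)
  qed
  moreover have "POU D = POU_cut D"
    unfolding POU_def POU_cut_def POU_of_def by (rule sum.cong) (simp_all add: eq)
  ultimately show ?thesis by blast
qed

end
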